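(* Let $H\subset\mathbb{N}^n$ be an affine semigroup and let $S$ be a submonoid of $H$. Then $S$ is a divisor-closed submonoid of $H$ if and only if there exists a face $F$ of $\mathrm{L}_{\mathbb{Q}_+}(H)$ such that $S=F\cap H$.
   Context: $\mathbb{N}$ denotes the nonnegative integers and $\mathbb{Q}_+$ the nonnegative rationals. An affine semigroup is a finitely generated submonoid of $(\mathbb{N}^n,+)$; submonoids contain $0$. A submonoid $S$ of a commutative monoid $H$ is divisor-closed if $b,c\in H$ and $b+c\in S$ imply $b,c\in S$. The rational cone of $H$ is $\mathrm{L}_{\mathbb{Q}_+}(H)=\{\sum_{i=1}^r\lambda_i h_i \mid r\in\mathbb{N},\ h_i\in H,\ \lambda_i\in\mathbb{Q}_+\}\subset\mathbb{Q}^n$. A face of a cone $\mathbf C\subset\mathbb{Q}^n$ is a set of the form $\mathrm{face}_\omega(\mathbf C)=\{x\in\mathbf C\mid x\cdot\omega\geq y\cdot\omega\text{ for all }y\in\mathbf C\}$ for some $\omega\in\mathbb{R}^n$, where $\cdot$ is the dot product. *)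

theory Defs
  imports "HOL-Analysis.Analysis"
begin

definition add_submonoid :: "'a::comm_monoid_add set \<Rightarrow> bool" where
  "add_submonoid S \<longleftrightarrow> 0 \<in> S \<and> (\<forall>x\<in>S. \<forall>y\<in>S. x + y \<in> S)"

text \<open>The ambient monoid \<open>\<nat>\<^sup>n\<close> is the type \<open>nat ^ 'n\<close>, with \<open>n = CARD('n)\<close>.\<close>

definition affine_semigroup :: "(nat ^ 'n) set \<Rightarrow> bool" where
  "affine_semigroup H \<longleftrightarrow> (\<exists>A. finite A \<and> H = add_submonoid hull A)"

definition divisor_closed_submonoid :: "'a::comm_monoid_add set \<Rightarrow> 'a set \<Rightarrow> bool" where
  "divisor_closed_submonoid S H \<longleftrightarrow>
     add_submonoid S \<and> S \<subseteq> H \<and> (\<forall>b\<in>H. \<forall>c\<in>H. b + c \<in> S \<longrightarrow> b \<in> S \<and> c \<in> S)"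

definition rat_vec :: "nat ^ 'n \<Rightarrow> rat ^ 'n" where
  "rat_vec x = (\<chi> i. of_nat (x $ i))"

definition real_vec :: "rat ^ 'n \<Rightarrow> real ^ 'n" where
  "real_vec x = (\<chi> i. of_rat (x $ i))"

definition rational_cone :: "(nat ^ 'n) set \<Rightarrow> (rat ^ 'n) set" where
  "rational_cone H =
     {\<Sum>i<r. l i *s rat_vec (h i) | (r::nat) h l. \<forall>i<r. h i \<in> H \<and> 0 \<le> l i}"

text \<open>
  The cone consists of rational points, but the functional \<open>\<omega>\<close> may be any real vector.
  The library's \<open>face_of\<close> and \<open>exposed_face_of\<close> apply to subsets of real vector spaces only.
  As in the classical definition used here, the set below is empty if \<open>\<omega>\<close> is unbounded
  above on \<open>C\<close>.
\<close>

definition face :: "real ^ 'n \<Rightarrow> (rat ^ 'n) set \<Rightarrow> (rat ^ 'n) set" where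
  "face \<omega> C = {x \<in> C. \<forall>y\<in>C. real_vec x \<bullet> \<omega> \<ge> real_vec y \<bullet> \<omega>}"

definition is_face :: "(rat ^ 'n) set \<Rightarrow> (rat ^ 'n) set \<Rightarrow> bool" where
  "is_face F C \<longleftrightarrow> (\<exists>\<omega>. F = face \<omega> C)"

end

theory Submission imports Defs begin

text \<open>
  If \<open>S = F \<inter> H\<close> for the face \<open>F\<close> cut out by \<open>\<omega>\<close>, then \<open>0 \<in> F\<close>, so that \<open>\<omega>\<close> is nonpositive on
  the cone and \<open>F\<close> is its zero set. A sum of two nonpositive values vanishes only if both do;
  hence \<open>S\<close> is divisor-closed.

  Conversely, let \<open>A\<close> be a finite generating set of \<open>H\<close>, and let \<open>s\<close> be the sum of the generators
  in \<open>S\<close>. It suffices to find, for each generator \<open>a \<notin> S\<close>, a functional that is nonpositive on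
  \<open>A\<close>, nonnegative at \<open>s\<close> and negative at \<open>a\<close>: the sum \<open>\<omega>\<close> of these functionals is nonpositive on
  \<open>H\<close> and its zero set in \<open>H\<close> is \<open>S\<close> (lemma \<open>divisor_closed_supporting_functional\<close>).
  If there is no such functional for \<open>a\<close>, a theorem of the alternative
  (\<open>functional_or_nonneg_relation\<close>, which separates \<open>- a\<close> from the closed cone generated by
  \<open>A \<union> {- s}\<close>) yields a relation with nonnegative real coefficients between the elements of
  \<open>A \<union> {- s}\<close> in which \<open>a\<close> has a positive coefficient. The vectors are integral, and so simultaneous
  Diophantine approximation turns it into a relation with natural coefficients
  (\<open>nonneg_relation_imp_nat_relation\<close>). It says that a multiple of \<open>s\<close>, an element of \<open>S\<close>, is a
  sum of generators that include \<open>a\<close>. As \<open>S\<close> is divisor-closed, \<open>a \<in> S\<close>, a contradiction.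
\<close>

section \<open>Nonnegative relations between vectors\<close>

lemma convex_cone_hull_finite_subset:
  fixes X :: "'a::real_vector set"
  assumes X: "finite X" and y: "y \<in> convex_cone hull X"
  obtains c where "\<And>x. x \<in> X \<Longrightarrow> 0 \<le> c x" and "y = (\<Sum>x\<in>X. c x *\<^sub>R x)"
proof -
  let ?K = "{y. \<exists>c. (\<forall>x\<in>X. 0 \<le> c x) \<and> y = (\<Sum>x\<in>X. c x *\<^sub>R x)}"
  have "convex_cone hull X \<subseteq> ?K"
  proof (rule hull_minimal)
    show "X \<subseteq> ?K"
    proof
      fix z assume z: "z \<in> X"
      have "(\<Sum>x\<in>X. (if x = z then 1 else 0) *\<^sub>R x) = (\<Sum>x\<in>X. if x = z then x else 0)"
        by (rule sum.cong) auto
      also have "\<dots> = z" using X z by simp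
      finally show "z \<in> ?K"
        by (auto intro!: exI[of _ "\<lambda>x. if x = z then 1 else 0"])
    qed
    show "convex_cone ?K"
      unfolding convex_cone_iff
    proof (intro conjI ballI allI impI)
      have "(0::'a) = (\<Sum>x\<in>X. 0 *\<^sub>R x)" by simp
      then show "0 \<in> ?K" by (auto intro!: exI[of _ "\<lambda>_. 0"])
    next
      fix u v assume "u \<in> ?K" "v \<in> ?K"
      then obtain c d where
        "\<forall>x\<in>X. 0 \<le> c x" "u = (\<Sum>x\<in>X. c x *\<^sub>R x)"
        "\<forall>x\<in>X. 0 \<le> d x" "v = (\<Sum>x\<in>X. d x *\<^sub>R x)" by blast
      then show "u + v \<in> ?K"
        by (auto intro!: exI[of _ "\<lambda>x. c x + d x"] simp: sum.distrib scaleR_left_distrib)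
    next
      fix u and t :: real assume "u \<in> ?K" "0 \<le> t"
      moreover from \<open>u \<in> ?K\<close> obtain c where
        "\<forall>x\<in>X. 0 \<le> c x" "u = (\<Sum>x\<in>X. c x *\<^sub>R x)" by blast
      ultimately show "t *\<^sub>R u \<in> ?K"
        by (auto intro!: exI[of _ "\<lambda>x. t * c x"] simp: scaleR_sum_right)
    qed
  qed
  with y that show thesis by blast
qed

text \<open>A variant of Farkas' lemma. Either a functional separates \<open>- z\<close> from the cone generated by \<open>X\<close>,
  or a representation of \<open>- z\<close> as an element of this cone gives the relation.\<close>

lemma functional_or_nonneg_relation:
  fixes X :: "'a::euclidean_space set"
  assumes X: "finite X" and z: "z \<in> X"
  obtains (functional) \<omega> where "\<And>x. x \<in> X \<Longrightarrow> x \<bullet> \<omega> \<le> 0" and "z \<bullet> \<omega> < 0"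
  | (relation) c where "\<And>x. x \<in> X \<Longrightarrow> 0 \<le> c x" and "c z > 0" and "(\<Sum>x\<in>X. c x *\<^sub>R x) = 0"
proof (cases "- z \<in> convex_cone hull X")
  case True
  then obtain c where c: "\<And>x. x \<in> X \<Longrightarrow> 0 \<le> c x" "- z = (\<Sum>x\<in>X. c x *\<^sub>R x)"
    using convex_cone_hull_finite_subset[OF X] by metis
  let ?d = "\<lambda>x. c x + (if x = z then 1 else 0)"
  have "(\<Sum>x\<in>X. ?d x *\<^sub>R x) = (\<Sum>x\<in>X. c x *\<^sub>R x + (if x = z then x else 0))"
    by (rule sum.cong) (auto simp: scaleR_left_distrib)
  also have "\<dots> = - z + z" using X z c(2) by (simp add: sum.distrib)
  finally show thesis
    using c(1) z by (intro relation[of ?d]) (auto intro: add_nonneg_pos)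
next
  case False
  let ?K = "convex_cone hull X"
  obtain a b where ab: "a \<bullet> (- z) < b" "\<And>k. k \<in> ?K \<Longrightarrow> a \<bullet> k > b"
    using separating_hyperplane_closed_point[OF convex_convex_cone_hull
        closed_convex_cone_hull[OF X] False] by blast
  have "b < 0" using ab(2)[OF convex_cone_hull_contains_0] by simp
  have "a \<bullet> k \<ge> 0" if k: "k \<in> ?K" for k
  proof (rule ccontr)
    assume "\<not> a \<bullet> k \<ge> 0"
    \<comment> \<open>The multiple of \<open>k\<close> at which the functional takes the value \<open>b\<close> lies in the cone.\<close>
    with \<open>b < 0\<close> have "0 \<le> b / (a \<bullet> k)" "a \<bullet> ((b / (a \<bullet> k)) *\<^sub>R k) = b"
      by (auto simp: divide_nonpos_neg)
    with ab(2)[OF convex_cone_hull_mul[OF k]] show False by fastforce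
  qed
  then have "a \<bullet> x \<ge> 0" if "x \<in> X" for x
    using that by (simp add: hull_inc)
  then have "x \<bullet> (- a) \<le> 0" if "x \<in> X" for x
    using that by (simp add: inner_commute[of x])
  moreover have "z \<bullet> (- a) < 0"
    using ab(1) \<open>b < 0\<close> by (simp add: inner_commute)
  ultimately show thesis by (rule functional)
qed

text \<open>
  Dirichlet's theorem makes all multiples \<open>q * c x\<close> of the real coefficients nearly integral at
  once. After rounding, the integral combination is an integral vector of small size, hence zero.
\<close>

lemma nonneg_relation_imp_nat_relation:
  fixes X :: "(real ^ 'n) set"
  assumes X: "finite X" and int: "\<And>x i. x \<in> X \<Longrightarrow> x $ i \<in> \<int>"
    and nonneg: "\<And>x. x \<in> X \<Longrightarrow> 0 \<le> c x" and z: "z \<in> X" "c z > 0"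
    and rel: "(\<Sum>x\<in>X. c x *\<^sub>R x) = 0"
  obtains p :: "real ^ 'n \<Rightarrow> nat" where "p z > 0" and "(\<Sum>x\<in>X. real (p x) *\<^sub>R x) = 0"
proof -
  \<comment> \<open>Normalizing the coefficient of \<open>z\<close> to 1 ensures that it does not round to 0.\<close>
  define d where "d x = c x / c z" for x
  have d: "\<And>x. x \<in> X \<Longrightarrow> 0 \<le> d x" "d z = 1"
    using nonneg z by (auto simp: d_def)
  have "(\<Sum>x\<in>X. d x *\<^sub>R x) = (1 / c z) *\<^sub>R (\<Sum>x\<in>X. c x *\<^sub>R x)"
    by (simp add: d_def scaleR_sum_right)
  with rel have reld: "(\<Sum>x\<in>X. d x *\<^sub>R x) = 0" by simp
  define M where "M = (\<Sum>x\<in>X. norm x)"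
  have M0: "M \<ge> 0" by (simp add: M_def sum_nonneg)
  obtain N :: nat where N: "real N > M" using reals_Archimedean2 by blast
  then have N0: "N > 0" using M0 by (cases N) auto
  obtain e where e: "bij_betw e {0..<card X} X"
    using ex_bij_betw_nat_finite[OF X] by blast
  obtain q k where q: "0 < q" and k: "\<And>i. i < card X \<Longrightarrow>
      \<bar>real_of_int q * d (e i) - real_of_int (k i)\<bar> < 1 / N"
    using Dirichlet_approx_simult[OF N0, of "card X" "\<lambda>i. d (e i)"] by metis
  define P where "P x = k (the_inv_into {0..<card X} e x)" for x
  have P: "\<bar>real_of_int q * d x - real_of_int (P x)\<bar> < 1 / N" if "x \<in> X" for x
  proof -
    have "the_inv_into {0..<card X} e x \<in> {0..<card X}"
      using e that by (metis bij_betw_def the_inv_into_into order_refl)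
    moreover have "e (the_inv_into {0..<card X} e x) = x"
      using e that by (metis f_the_inv_into_f_bij_betw)
    ultimately show ?thesis using k unfolding P_def by fastforce
  qed
  have N1: "1 / real N \<le> 1" using N0 by simp
  have P0: "P x \<ge> 0" if "x \<in> X" for x
  proof -
    have "0 \<le> real_of_int q * d x" using q d(1)[OF that] by simp
    with P[OF that] N1 have "real_of_int (P x) > -1" by linarith
    then show ?thesis by linarith
  qed
  have "P z = q"
    using P[OF z(1)] N1 d(2) by simp
  have "(\<Sum>x\<in>X. real_of_int (P x) *\<^sub>R x) $ j = 0" for j
  proof -
    let ?t = "\<Sum>x\<in>X. real_of_int (P x) * x $ j"
    have "(\<Sum>x\<in>X. d x * x $ j) = 0"
      using arg_cong[OF reld, of "\<lambda>v. v $ j"] by simp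
    then have "(\<Sum>x\<in>X. real_of_int q * d x * x $ j) = 0"
      by (simp add: mult.assoc flip: sum_distrib_left)
    then have "?t = (\<Sum>x\<in>X. (real_of_int (P x) - real_of_int q * d x) * x $ j)"
      by (simp add: left_diff_distrib sum_subtractf)
    also have "\<bar>\<dots>\<bar> \<le> (\<Sum>x\<in>X. 1 / N * norm x)"
    proof (rule order_trans[OF sum_abs], rule sum_mono)
      fix x assume "x \<in> X"
      then show "\<bar>(real_of_int (P x) - real_of_int q * d x) * x $ j\<bar> \<le> 1 / N * norm x"
        unfolding abs_mult using P[of x] component_le_norm_cart[of x j]
        by (intro mult_mono) (auto simp: abs_minus_commute)
    qed
    also have "\<dots> = M / N" by (simp add: M_def sum_divide_distrib)
    also have "\<dots> < 1" using N N0 by simp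
    finally have "\<bar>?t\<bar> < 1" .
    moreover have "?t \<in> \<int>" using int by (intro Ints_sum Ints_mult) auto
    ultimately have "?t = 0" using Ints_nonzero_abs_less1 by blast
    then show ?thesis by simp
  qed
  then have "(\<Sum>x\<in>X. real_of_int (P x) *\<^sub>R x) = 0" by (simp add: vec_eq_iff)
  moreover have "(\<Sum>x\<in>X. real (nat (P x)) *\<^sub>R x) = (\<Sum>x\<in>X. real_of_int (P x) *\<^sub>R x)"
    using P0 by (intro sum.cong) auto
  ultimately show thesis
    using \<open>P z = q\<close> q by (intro that[of "\<lambda>x. nat (P x)"]) auto
qed

section \<open>Submonoids\<close>

lemma add_submonoid_hull: "add_submonoid (add_submonoid hull A)"
  by (rule hull_in) (auto simp: add_submonoid_def)

lemma add_submonoid_sum: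
  assumes "add_submonoid S" and "\<And>x. x \<in> X \<Longrightarrow> f x \<in> S"
  shows "sum f X \<in> S"
  using assms(2)
proof (induction X rule: infinite_finite_induct)
  case (insert x F)
  then show ?case using assms(1) by (simp add: add_submonoid_def)
qed (use assms(1) in \<open>auto simp: add_submonoid_def\<close>)

lemma add_submonoid_scale:
  fixes x :: "nat ^ 'n"
  assumes S: "add_submonoid S" and x: "x \<in> S"
  shows "m *s x \<in> S"
proof (induction m)
  case 0
  then show ?case using S by (simp add: add_submonoid_def)
next
  case (Suc m)
  have "Suc m *s x = x + m *s x" by (simp add: vec_eq_iff)
  with Suc x S show ?case by (simp add: add_submonoid_def)
qed

section \<open>Real points of the rational cone\<close>

text \<open>The embedding of \<open>\<nat>\<^sup>n\<close> into \<open>\<real>\<^sup>n\<close>.\<close>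

definition nat_to_real_vec :: "nat ^ 'n \<Rightarrow> real ^ 'n" where
  "nat_to_real_vec x = real_vec (rat_vec x)"

lemma nat_to_real_vec_nth [simp]: "nat_to_real_vec x $ i = real (x $ i)"
  by (simp add: nat_to_real_vec_def real_vec_def rat_vec_def)

lemma nat_to_real_vec_eq_iff [simp]: "nat_to_real_vec x = nat_to_real_vec y \<longleftrightarrow> x = y"
  by (simp add: vec_eq_iff)

lemma nat_to_real_vec_0 [simp]: "nat_to_real_vec 0 = 0"
  by (simp add: vec_eq_iff)

lemma nat_to_real_vec_add: "nat_to_real_vec (x + y) = nat_to_real_vec x + nat_to_real_vec y"
  by (simp add: vec_eq_iff)

lemma nat_to_real_vec_scale: "nat_to_real_vec (m *s x) = real m *\<^sub>R nat_to_real_vec x"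
  by (simp add: vec_eq_iff)

lemma nat_to_real_vec_sum: "nat_to_real_vec (sum f X) = (\<Sum>x\<in>X. nat_to_real_vec (f x))"
  by (induction X rule: infinite_finite_induct) (auto simp: nat_to_real_vec_add)

lemma rat_vec_eq_iff: "rat_vec x = rat_vec y \<longleftrightarrow> x = y"
  by (simp add: rat_vec_def vec_eq_iff)

lemma rat_vec_in_rational_cone:
  assumes "h \<in> H"
  shows "rat_vec h \<in> rational_cone H"
  unfolding rational_cone_def mem_Collect_eq
  by (rule exI[of _ 1], rule exI[of _ "\<lambda>_. h"], rule exI[of _ "\<lambda>_. 1"]) (simp add: assms)

lemma rational_cone_nonpos:
  assumes H: "\<And>h. h \<in> H \<Longrightarrow> nat_to_real_vec h \<bullet> \<omega> \<le> 0" and y: "y \<in> rational_cone H"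
  shows "real_vec y \<bullet> \<omega> \<le> 0"
proof -
  obtain r :: nat and h l where y: "y = (\<Sum>i<r. l i *s rat_vec (h i))"
    and h: "\<forall>i<r. h i \<in> H \<and> 0 \<le> l i"
    using y unfolding rational_cone_def by blast
  have "real_vec y = (\<Sum>i<r. real_of_rat (l i) *\<^sub>R nat_to_real_vec (h i))"
    by (simp add: y vec_eq_iff real_vec_def of_rat_sum of_rat_mult rat_vec_def)
  then have "real_vec y \<bullet> \<omega> = (\<Sum>i<r. real_of_rat (l i) * (nat_to_real_vec (h i) \<bullet> \<omega>))"
    by (simp add: inner_sum_left)
  also have "\<dots> \<le> 0"
    using h H by (intro sum_nonpos mult_nonneg_nonpos) auto
  finally show ?thesis .
qed

section \<open>Functionals that cut out a divisor-closed submonoid\<close>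

lemma divisor_closed_separating_functional:
  fixes A :: "(nat ^ 'n) set"
  assumes A: "finite A" and dc: "divisor_closed_submonoid S (add_submonoid hull A)"
    and a: "a \<in> A" "a \<notin> S" and s: "s \<in> S"
  obtains \<omega> where "\<And>y. y \<in> A \<Longrightarrow> nat_to_real_vec y \<bullet> \<omega> \<le> 0"
    and "nat_to_real_vec s \<bullet> \<omega> \<ge> 0" and "nat_to_real_vec a \<bullet> \<omega> < 0"
proof -
  let ?H = "add_submonoid hull A" and ?v = "nat_to_real_vec"
  let ?X = "insert (- ?v s) (?v ` A)"
  have S: "add_submonoid S" and
    div: "\<And>b c. b \<in> ?H \<Longrightarrow> c \<in> ?H \<Longrightarrow> b + c \<in> S \<Longrightarrow> b \<in> S \<and> c \<in> S"
    using dc unfolding divisor_closed_submonoid_def by auto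
  have X: "finite ?X" and aX: "?v a \<in> ?X" using A a by auto
  from X aX show thesis
  proof (cases rule: functional_or_nonneg_relation)
    case (functional \<omega>)
    from functional(1)[of "- ?v s"] have "?v s \<bullet> \<omega> \<ge> 0" by simp
    with functional show thesis by (intro that[of \<omega>]) auto
  next
    case (relation c)
    have int: "x $ i \<in> \<int>" if "x \<in> ?X" for x i using that by auto
    obtain p where p: "p (?v a) > 0" "(\<Sum>x\<in>?X. real (p x) *\<^sub>R x) = 0"
      using nonneg_relation_imp_nat_relation[OF X int relation(1) aX relation(2,3)] by blast
    \<comment> \<open>In the degenerate case \<open>s = 0\<close> the vector \<open>- s\<close> may also be a generator; it is counted
      only once in \<open>?X\<close>, and is left out of \<open>B\<close>.\<close>
    define B where "B = {y \<in> A. ?v y \<noteq> - ?v s}"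
    have B: "finite B" "B \<subseteq> A" using A by (auto simp: B_def)
    have "0 \<in> S" using S by (simp add: add_submonoid_def)
    with a(2) have "a \<noteq> 0" by auto
    then obtain i where "a $ i \<noteq> 0" by (auto simp: vec_eq_iff)
    then have "?v a $ i \<noteq> (- ?v s) $ i" by simp
    then have aB: "a \<in> B" using a(1) unfolding B_def by (metis (mono_tags, lifting) mem_Collect_eq)
    have "?X - {- ?v s} = ?v ` B" by (auto simp: B_def)
    then have "(\<Sum>x\<in>?X. real (p x) *\<^sub>R x)
        = real (p (- ?v s)) *\<^sub>R (- ?v s) + (\<Sum>x\<in>?v ` B. real (p x) *\<^sub>R x)"
      using sum.remove[OF X, of "- ?v s" "\<lambda>x. real (p x) *\<^sub>R x"] by simp
    also have "(\<Sum>x\<in>?v ` B. real (p x) *\<^sub>R x) = (\<Sum>y\<in>B. real (p (?v y)) *\<^sub>R ?v y)"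
      by (subst sum.reindex) (auto simp: inj_on_def)
    finally have "?v (\<Sum>y\<in>B. p (?v y) *s y) = ?v (p (- ?v s) *s s)"
      using p(2) by (simp add: nat_to_real_vec_sum nat_to_real_vec_scale)
    then have eq: "(\<Sum>y\<in>B. p (?v y) *s y) = p (- ?v s) *s s" by simp
    let ?c = "(p (?v a) - 1) *s a + (\<Sum>y\<in>B - {a}. p (?v y) *s y)"
    have "p (?v a) *s a = a + (p (?v a) - 1) *s a"
      using p(1) by (cases "p (?v a)") (simp_all add: vec_eq_iff)
    then have "a + ?c = p (- ?v s) *s s"
      using eq sum.remove[OF B(1) aB, of "\<lambda>y. p (?v y) *s y"] by (simp add: add.assoc)
    then have "a + ?c \<in> S" using add_submonoid_scale[OF S s] by simp
    moreover have AH: "y \<in> ?H" if "y \<in> A" for y using that by (rule hull_inc)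
    moreover have "?c \<in> ?H"
    proof -
      have "(p (?v a) - 1) *s a \<in> ?H"
        using add_submonoid_scale[OF add_submonoid_hull AH[OF a(1)]] .
      moreover have "(\<Sum>y\<in>B - {a}. p (?v y) *s y) \<in> ?H"
        using AH B(2)
        by (intro add_submonoid_sum[OF add_submonoid_hull]
            add_submonoid_scale[OF add_submonoid_hull]) auto
      ultimately show ?thesis using add_submonoid_hull[of A] by (simp add: add_submonoid_def)
    qed
    ultimately have "a \<in> S" using div a(1) by blast
    with a(2) show thesis by blast
  qed
qed

lemma divisor_closed_supporting_functional:
  fixes H :: "(nat ^ 'n) set"
  assumes H: "affine_semigroup H" and dc: "divisor_closed_submonoid S H"
  obtains \<omega> where "\<And>h. h \<in> H \<Longrightarrow> nat_to_real_vec h \<bullet> \<omega> \<le> 0"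
    and "\<And>h. h \<in> H \<Longrightarrow> h \<in> S \<longleftrightarrow> nat_to_real_vec h \<bullet> \<omega> = 0"
proof -
  let ?v = nat_to_real_vec
  obtain A where A: "finite A" "H = add_submonoid hull A"
    using H unfolding affine_semigroup_def by blast
  have S: "add_submonoid S" and
    div: "\<And>b c. b \<in> H \<Longrightarrow> c \<in> H \<Longrightarrow> b + c \<in> S \<Longrightarrow> b \<in> S \<and> c \<in> S"
    using dc unfolding divisor_closed_submonoid_def by auto
  define s where "s = (\<Sum>b\<in>A \<inter> S. b)"
  have s: "s \<in> S" unfolding s_def by (rule add_submonoid_sum[OF S]) auto
  have "\<forall>a\<in>A - S. \<exists>w. (\<forall>y\<in>A. ?v y \<bullet> w \<le> 0) \<and> ?v s \<bullet> w \<ge> 0 \<and> ?v a \<bullet> w < 0"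
    using divisor_closed_separating_functional[OF A(1) dc[unfolded A(2)] _ _ s]
    by (metis DiffD1 DiffD2)
  then obtain w where w: "\<And>a y. a \<in> A - S \<Longrightarrow> y \<in> A \<Longrightarrow> ?v y \<bullet> w a \<le> 0"
      "\<And>a. a \<in> A - S \<Longrightarrow> ?v s \<bullet> w a \<ge> 0" "\<And>a. a \<in> A - S \<Longrightarrow> ?v a \<bullet> w a < 0"
    by metis
  define \<omega> where "\<omega> = (\<Sum>a\<in>A - S. w a)"
  have nonpos: "?v y \<bullet> \<omega> \<le> 0" if "y \<in> A" for y
    unfolding \<omega>_def inner_sum_right using that w(1) by (intro sum_nonpos) auto
  have "(\<Sum>b\<in>A \<inter> S. - (?v b \<bullet> \<omega>)) \<le> 0"
  proof -
    have "?v s \<bullet> \<omega> \<ge> 0"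
      unfolding \<omega>_def inner_sum_right using w(2) by (intro sum_nonneg) auto
    then show ?thesis by (simp add: s_def nat_to_real_vec_sum inner_sum_left sum_negf)
  qed
  then have "(\<Sum>b\<in>A \<inter> S. - (?v b \<bullet> \<omega>)) = 0"
    using nonpos by (intro antisym sum_nonneg) auto
  then have zero: "?v b \<bullet> \<omega> = 0" if "b \<in> A" "b \<in> S" for b
    using that nonpos A(1) by (subst (asm) sum_nonneg_eq_0_iff) auto
  have neg: "?v a \<bullet> \<omega> < 0" if a: "a \<in> A" "a \<notin> S" for a
  proof -
    have "?v a \<bullet> \<omega> = ?v a \<bullet> w a + (\<Sum>x\<in>A - S - {a}. ?v a \<bullet> w x)"
      unfolding \<omega>_def inner_sum_right using a A(1) by (intro sum.remove) auto
    moreover have "(\<Sum>x\<in>A - S - {a}. ?v a \<bullet> w x) \<le> 0"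
      using w(1) a by (intro sum_nonpos) auto
    ultimately show ?thesis using w(3)[of a] a by auto
  qed
  \<comment> \<open>For \<open>x, y \<in> ?T\<close>, both sides of the equivalence hold at \<open>x + y\<close> exactly if they hold at \<open>x\<close>
    and at \<open>y\<close>: the left one since \<open>S\<close> is divisor-closed, the right one by the signs. So \<open>?T\<close> is
    a submonoid.\<close>
  let ?T = "{h \<in> H. ?v h \<bullet> \<omega> \<le> 0 \<and> (h \<in> S \<longleftrightarrow> ?v h \<bullet> \<omega> = 0)}"
  have H': "add_submonoid H" unfolding A(2) by (rule add_submonoid_hull)
  have "H \<subseteq> ?T"
    unfolding A(2)
  proof (rule hull_minimal, fold A(2))
    show "A \<subseteq> ?T"
    proof
      fix a assume a: "a \<in> A"
      then have "a \<in> H" unfolding A(2) by (rule hull_inc)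
      with a nonpos[OF a] zero[OF a] neg[OF a] show "a \<in> ?T" by force
    qed
    show "add_submonoid ?T"
      unfolding add_submonoid_def
    proof (intro conjI ballI)
      show "0 \<in> ?T" using H' S by (simp add: add_submonoid_def)
    next
      fix x y assume x: "x \<in> ?T" and y: "y \<in> ?T"
      then have "x + y \<in> H" using H' by (simp add: add_submonoid_def)
      moreover have "x + y \<in> S \<longleftrightarrow> x \<in> S \<and> y \<in> S"
        using div[of x y] x y S by (auto simp: add_submonoid_def)
      ultimately show "x + y \<in> ?T"
        using x y by (auto simp: nat_to_real_vec_add inner_add_left)
    qed
  qed
  then show thesis by (intro that[of \<omega>]) auto
qed

section \<open>Divisor-closed submonoids and faces\<close>

theorem theorem15:
  fixes H S :: "(nat ^ 'n) set"
  assumes "affine_semigroup H"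
    and "add_submonoid S" and "S \<subseteq> H"
  shows "divisor_closed_submonoid S H \<longleftrightarrow>
    (\<exists>F. is_face F (rational_cone H) \<and> rat_vec ` S = F \<inter> rat_vec ` H)"
proof
  assume dc: "divisor_closed_submonoid S H"
  obtain \<omega> where nonpos: "\<And>h. h \<in> H \<Longrightarrow> nat_to_real_vec h \<bullet> \<omega> \<le> 0"
    and zero: "\<And>h. h \<in> H \<Longrightarrow> h \<in> S \<longleftrightarrow> nat_to_real_vec h \<bullet> \<omega> = 0"
    using divisor_closed_supporting_functional[OF assms(1) dc] by blast
  let ?F = "face \<omega> (rational_cone H)"
  have "0 \<in> H" using assms(2,3) by (auto simp: add_submonoid_def)
  have F: "rat_vec h \<in> ?F \<longleftrightarrow> h \<in> S" if h: "h \<in> H" for h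
  proof
    assume "rat_vec h \<in> ?F"
    then have "nat_to_real_vec h \<bullet> \<omega> \<ge> nat_to_real_vec 0 \<bullet> \<omega>"
      using rat_vec_in_rational_cone[OF \<open>0 \<in> H\<close>]
      unfolding face_def nat_to_real_vec_def by blast
    with nonpos[OF h] zero[OF h] show "h \<in> S" by simp
  next
    assume "h \<in> S"
    with zero[OF h] have "real_vec (rat_vec h) \<bullet> \<omega> = 0"
      unfolding nat_to_real_vec_def by blast
    then show "rat_vec h \<in> ?F"
      using rat_vec_in_rational_cone[OF h] rational_cone_nonpos[of H \<omega>] nonpos
      unfolding face_def by auto
  qed
  have "rat_vec ` S = ?F \<inter> rat_vec ` H"
    using F assms(3) by auto
  then show "\<exists>F. is_face F (rational_cone H) \<and> rat_vec ` S = F \<inter> rat_vec ` H"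
    unfolding is_face_def by blast
next
  assume "\<exists>F. is_face F (rational_cone H) \<and> rat_vec ` S = F \<inter> rat_vec ` H"
  then obtain \<omega> where eq: "rat_vec ` S = face \<omega> (rational_cone H) \<inter> rat_vec ` H"
    unfolding is_face_def by blast
  have mem: "h \<in> S \<longleftrightarrow> rat_vec h \<in> face \<omega> (rational_cone H)" if "h \<in> H" for h
  proof -
    have "h \<in> S \<longleftrightarrow> rat_vec h \<in> rat_vec ` S" by (auto simp: rat_vec_eq_iff)
    with that show ?thesis unfolding eq by blast
  qed
  have "0 \<in> S" using assms(2) by (simp add: add_submonoid_def)
  then have "rat_vec 0 \<in> face \<omega> (rational_cone H)" using mem assms(3) by blast
  then have nonpos: "real_vec y \<bullet> \<omega> \<le> 0" if "y \<in> rational_cone H" for y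
  proof -
    have "real_vec y \<bullet> \<omega> \<le> nat_to_real_vec 0 \<bullet> \<omega>"
      using \<open>rat_vec 0 \<in> _\<close> that unfolding face_def nat_to_real_vec_def by blast
    then show ?thesis by simp
  qed
  have zero: "h \<in> S \<longleftrightarrow> nat_to_real_vec h \<bullet> \<omega> = 0" if h: "h \<in> H" for h
  proof
    assume "h \<in> S"
    then have "rat_vec h \<in> face \<omega> (rational_cone H)" using mem[OF h] by blast
    then have "nat_to_real_vec h \<bullet> \<omega> \<ge> nat_to_real_vec 0 \<bullet> \<omega>"
      using rat_vec_in_rational_cone[of 0 H] \<open>0 \<in> S\<close> assms(3)
      unfolding face_def nat_to_real_vec_def by blast
    with nonpos[OF rat_vec_in_rational_cone[OF h]] show "nat_to_real_vec h \<bullet> \<omega> = 0"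
      by (simp flip: nat_to_real_vec_def)
  next
    assume "nat_to_real_vec h \<bullet> \<omega> = 0"
    then show "h \<in> S"
      using mem[OF h] nonpos rat_vec_in_rational_cone[OF h]
      by (auto simp: face_def nat_to_real_vec_def)
  qed
  have "b \<in> S \<and> c \<in> S" if b: "b \<in> H" and c: "c \<in> H" and bc: "b + c \<in> S" for b c
  proof -
    have "nat_to_real_vec b \<bullet> \<omega> + nat_to_real_vec c \<bullet> \<omega> = 0"
      using zero[of "b + c"] bc assms(3) by (auto simp: nat_to_real_vec_add inner_add_left)
    moreover have "nat_to_real_vec b \<bullet> \<omega> \<le> 0" "nat_to_real_vec c \<bullet> \<omega> \<le> 0"
      using nonpos rat_vec_in_rational_cone b c unfolding nat_to_real_vec_def by blast+
    ultimately show ?thesis using zero b c by auto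
  qed
  then show "divisor_closed_submonoid S H"
    using assms(2,3) unfolding divisor_closed_submonoid_def by blast
qed

end
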